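(* Let $L_{\mathcal{C}}=\{ww\mid w\in\{0,1\}^*\}$ be the binary copy language. Then every graph is $L_{\mathcal{C}}$-representable, i.e., $\mathcal{G}_{L_{\mathcal{C}}}$ is the class of all graphs.
   Context: All graphs are finite, simple, undirected, with nonempty vertex sets, and graph classes are considered up to isomorphism. For an alphabet $V$ and distinct $u,v\in V$, $h_{u,v}:V^*\to\{0,1\}^*$ is the monoid morphism with $u\mapsto 0$, $v\mapsto 1$ and $x\mapsto\lambda$ (empty word) for all other letters $x$. For a language $L\subseteq\{0,1\}^*$ closed under exchanging 0 and 1 and a nonempty word $w$ whose set of occurring letters is $V$, $G(L,w)$ is the graph with vertex set $V$ in which distinct $u,v$ are adjacent iff $h_{u,v}(w)\in L$. A graph is $L$-representable if it is isomorphic to some $G(L,w)$; $\mathcal{G}_L$ is the class of $L$-representable graphs. *)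

theory Defs
  imports "Graph_Theory.Graph_Theory"
begin

text \<open>
  Graphs are the AFP's symmetric, loop-free, finite pair digraphs: an undirected edge between
  \<open>u\<close> and \<open>v\<close> is the pair of arcs \<open>(u, v)\<close>, \<open>(v, u)\<close>.
  The vertex set of \<^const>\<open>pair_graph\<close> may be empty, so nonemptiness is added.
\<close>

definition simple_graph :: "'a pair_pre_digraph \<Rightarrow> bool" where
  "simple_graph G \<longleftrightarrow> pair_graph G \<and> pverts G \<noteq> {}"

text \<open>Binary words are lists of booleans, with \<^const>\<open>False\<close> as 0 and \<^const>\<open>True\<close> as 1.\<close>

type_synonym binary_language = "bool list set"

definition exchange_closed :: "binary_language \<Rightarrow> bool" where
  "exchange_closed L \<longleftrightarrow> (\<forall>w\<in>L. map Not w \<in> L)"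

definition proj_morphism :: "'v \<Rightarrow> 'v \<Rightarrow> 'v list \<Rightarrow> bool list" where
  "proj_morphism u v w =
     concat (map (\<lambda>x. if x = u then [False] else if x = v then [True] else []) w)"

definition word_graph :: "binary_language \<Rightarrow> 'v list \<Rightarrow> 'v pair_pre_digraph" where
  "word_graph L w =
     \<lparr>pverts = set w,
      parcs = {(u, v). u \<in> set w \<and> v \<in> set w \<and> u \<noteq> v \<and> proj_morphism u v w \<in> L}\<rparr>"

text \<open>
  The alphabet of \<open>w\<close> is its set of letters, hence finite, so up to renaming of letters
  (which does not change the isomorphism type of the graph) it consists of natural numbers.
\<close>

definition L_representable :: "binary_language \<Rightarrow> 'a pair_pre_digraph \<Rightarrow> bool" where
  "L_representable L G \<longleftrightarrow>
     (\<exists>w :: nat list. w \<noteq> [] \<and> digraph_iso (with_proj G) (with_proj (word_graph L w)))"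

definition representable_graphs :: "binary_language \<Rightarrow> 'a pair_pre_digraph set" where
  "representable_graphs L = {G. simple_graph G \<and> L_representable L G}"

definition copy_language :: binary_language where
  "copy_language = {w @ w | w. True}"

text \<open>
  Representability is meant for exchange-closed languages only: there the arc relation is symmetric
  and \<^const>\<open>word_graph\<close> is a graph. The copy language is one of them.
\<close>

lemma proj_morphism_swap:
  assumes "u \<noteq> v"
  shows "proj_morphism v u w = map Not (proj_morphism u v w)"
  using assms by (induction w) (auto simp: proj_morphism_def)

lemma simple_graph_word_graph:
  assumes "exchange_closed L" "w \<noteq> []"
  shows "simple_graph (word_graph L w)"
proof -
  have fin: "finite (parcs (word_graph L w))"
    by (rule finite_subset[of _ "set w \<times> set w"]) (auto simp: word_graph_def)
  have "sym (parcs (word_graph L w))"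
    using assms(1) by (auto simp: sym_def word_graph_def exchange_closed_def proj_morphism_swap)
  then have "pair_graph (word_graph L w)"
    using fin by unfold_locales (auto simp: word_graph_def symmetric_def)
  then show ?thesis
    using assms(2) by (simp add: simple_graph_def word_graph_def)
qed

lemma exchange_closed_copy_language: "exchange_closed copy_language"
  by (auto simp: exchange_closed_def copy_language_def)

end

theory Submission
  imports Defs
begin

text \<open>
  List the ordered pairs of distinct nonadjacent vertices as \<open>(a\<^sub>1, b\<^sub>1), \<dots>, (a\<^sub>k, b\<^sub>k)\<close>, let \<open>z\<close>
  list all vertices, and take the word \<open>a\<^sub>1 b\<^sub>1 \<dots> a\<^sub>k b\<^sub>k z b\<^sub>1 a\<^sub>1 \<dots> b\<^sub>k a\<^sub>k z\<close>. For every pair \<open>u, v\<close>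
  the two halves have projections of equal length, so the projection is a square iff these
  agree factor by factor. Exchanging \<open>a\<^sub>i\<close> and \<open>b\<^sub>i\<close> is visible only to the pair
  \<open>{a\<^sub>i, b\<^sub>i}\<close>, so the projection is a square iff \<open>{u, v}\<close> is not a listed pair.
\<close>

text \<open>Equal lengths force any decomposition as a square to cut exactly between
  \<open>x\<close> and \<open>y\<close>.\<close>

lemma append_in_copy_language_iff:
  assumes "length x = length y"
  shows "x @ y \<in> copy_language \<longleftrightarrow> x = y"
proof
  assume "x @ y \<in> copy_language"
  then obtain w where w: "x @ y = w @ w"
    by (auto simp: copy_language_def)
  then have "length x = length w"
    using assms by (metis add_self_div_2 length_append)
  then show "x = y"
    using w by simp
qed (auto simp: copy_language_def)

text \<open>Corresponding blocks have equal length, so block boundaries align and the blocks can be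
  compared one by one.\<close>

lemma concat_map_eq_iff:
  assumes "\<And>p. p \<in> set ps \<Longrightarrow> length (f p) = length (g p)"
  shows "concat (map f ps) = concat (map g ps) \<longleftrightarrow> (\<forall>p\<in>set ps. f p = g p)"
  using assms by (induction ps) auto

lemma proj_morphism_append:
  "proj_morphism u v (x @ y) = proj_morphism u v x @ proj_morphism u v y"
  by (simp add: proj_morphism_def)

lemma proj_morphism_concat:
  "proj_morphism u v (concat xs) = concat (map (proj_morphism u v) xs)"
  by (induction xs) (simp_all add: proj_morphism_def)

lemma proj_morphism_map:
  assumes "inj_on f (insert u (insert v (set w)))"
  shows "proj_morphism (f u) (f v) (map f w) = proj_morphism u v w"
proof -
  have "f x = f u \<longleftrightarrow> x = u" "f x = f v \<longleftrightarrow> x = v" if "x \<in> set w" for x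
    using that by (simp_all add: inj_on_eq_iff[OF assms])
  then show ?thesis
    unfolding proj_morphism_def by (simp add: comp_def cong: map_cong if_cong)
qed

lemma length_proj_morphism_transposed:
  "length (proj_morphism u v [a, b]) = length (proj_morphism u v [b, a])"
  by (simp add: proj_morphism_def)

text \<open>If the two pairs coincide, the projections are 01 and 10 in some order; otherwise at
  most one letter survives and its position is invisible.\<close>

lemma proj_morphism_transposed_eq_iff:
  assumes "a \<noteq> b" "u \<noteq> v"
  shows "proj_morphism u v [a, b] = proj_morphism u v [b, a] \<longleftrightarrow> {a, b} \<noteq> {u, v}"
  using assms by (auto simp: proj_morphism_def doubleton_eq_iff)

text \<open>The copies of \<open>z\<close> make every vertex occur, even one adjacent to all others,
  and add the same block to both halves.\<close>

definition copy_word :: "('v \<times> 'v) list \<Rightarrow> 'v list \<Rightarrow> 'v list" where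
  "copy_word ps z =
     (concat (map (\<lambda>(a, b). [a, b]) ps) @ z) @ (concat (map (\<lambda>(a, b). [b, a]) ps) @ z)"

lemma set_copy_word:
  assumes "set ps \<subseteq> set z \<times> set z"
  shows "set (copy_word ps z) = set z"
  using assms by (auto simp: copy_word_def)

lemma proj_copy_word_in_copy_language_iff:
  assumes "\<And>a b. (a, b) \<in> set ps \<Longrightarrow> a \<noteq> b" "u \<noteq> v"
  shows "proj_morphism u v (copy_word ps z) \<in> copy_language \<longleftrightarrow>
    (u, v) \<notin> set ps \<and> (v, u) \<notin> set ps"
proof -
  define f where "f = (\<lambda>p. proj_morphism u v [fst p, snd p])"
  define g where "g = (\<lambda>p. proj_morphism u v [snd p, fst p])"
  have len: "length (f p) = length (g p)" for p
    by (simp add: f_def g_def length_proj_morphism_transposed)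
  then have len_concat: "length (concat (map f ps)) = length (concat (map g ps))"
    by (simp add: length_concat comp_def)
  have "proj_morphism u v (copy_word ps z) =
      (concat (map f ps) @ proj_morphism u v z) @ (concat (map g ps) @ proj_morphism u v z)"
    by (simp add: copy_word_def proj_morphism_append proj_morphism_concat comp_def
        case_prod_beta f_def g_def)
  then have "proj_morphism u v (copy_word ps z) \<in> copy_language \<longleftrightarrow>
      concat (map f ps) = concat (map g ps)"
    \<comment> \<open>Reassociating the appends would hide the split at the midpoint.\<close>
    using len_concat by (simp add: append_in_copy_language_iff del: append_assoc)
  also have "\<dots> \<longleftrightarrow> (\<forall>p\<in>set ps. f p = g p)"
    by (rule concat_map_eq_iff) (rule len)
  also have "\<dots> \<longleftrightarrow> (\<forall>(a, b)\<in>set ps. {a, b} \<noteq> {u, v})"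
    using assms by (intro ball_cong) (auto simp: f_def g_def proj_morphism_transposed_eq_iff)
  also have "\<dots> \<longleftrightarrow> (u, v) \<notin> set ps \<and> (v, u) \<notin> set ps"
    by (auto simp: doubleton_eq_iff)
  finally show ?thesis .
qed

text \<open>Taking the vertices themselves as letters gives equality, not just isomorphism.\<close>

lemma simple_graph_eq_word_graph_copy_language:
  assumes "simple_graph G"
  obtains w where "w \<noteq> []" "G = word_graph copy_language w"
proof -
  interpret pair_graph G
    using assms by (simp add: simple_graph_def)
  obtain z where z: "set z = pverts G"
    using finite_list[OF pair_finite_verts] by blast
  have "finite {(a, b). a \<in> pverts G \<and> b \<in> pverts G \<and> a \<noteq> b \<and> (a, b) \<notin> parcs G}"
    by (rule finite_subset[of _ "pverts G \<times> pverts G"]) (auto simp: pair_finite_verts)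
  then obtain ps where ps:
    "set ps = {(a, b). a \<in> pverts G \<and> b \<in> pverts G \<and> a \<noteq> b \<and> (a, b) \<notin> parcs G}"
    by (blast dest: finite_list)
  have verts: "set (copy_word ps z) = pverts G"
    using ps z by (subst set_copy_word) auto
  have sym: "(v, u) \<in> parcs G" if "(u, v) \<in> parcs G" for u v
    using pair_sym_arcs that by (simp add: symmetric_def symD)
  \<comment> \<open>By symmetry of the arcs, \<open>ps\<close> contains both orders of a nonadjacent
    pair or neither.\<close>
  have arcs: "proj_morphism u v (copy_word ps z) \<in> copy_language \<longleftrightarrow> (u, v) \<in> parcs G"
    if "u \<in> pverts G" "v \<in> pverts G" "u \<noteq> v" for u v
    using that sym[of u v] sym[of v u]
    by (subst proj_copy_word_in_copy_language_iff) (auto simp: ps)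
  \<comment> \<open>For pairs not covered by \<open>arcs\<close> both sides are false: arcs of
    \<open>G\<close> join distinct vertices.\<close>
  have "(u, v) \<in> parcs G \<longleftrightarrow> (u, v) \<in> parcs (word_graph copy_language (copy_word ps z))" for u v
    using arcs[of u v] in_arcsD1[of u v] in_arcsD2[of u v] pair_no_loops[of "(u, v)"]
    by (auto simp: word_graph_def verts)
  then have "parcs G = parcs (word_graph copy_language (copy_word ps z))"
    by auto
  then have "G = word_graph copy_language (copy_word ps z)"
    by (intro pair_pre_digraph.equality) (simp_all add: word_graph_def verts)
  moreover have "copy_word ps z \<noteq> []"
    using assms verts by (auto simp: simple_graph_def)
  ultimately show thesis
    using that by blast
qed

text \<open>Projections only test letters for equality, so an injective renaming preserves them and
  hence adjacency.\<close>

lemma digraph_iso_word_graph_map: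
  assumes "inj_on f (set w)"
  shows "digraph_iso (with_proj (word_graph L w)) (with_proj (word_graph L (map f w)))"
proof -
  let ?G = "with_proj (word_graph L w)"
  let ?h = "\<lparr>iso_verts = f, iso_arcs = map_prod f f, iso_head = snd, iso_tail = fst\<rparr>"
  have "inj_on (map_prod f f) (set w \<times> set w)"
    using assms by (rule map_prod_inj_on) (rule assms)
  then have "inj_on (map_prod f f) (parcs (word_graph L w))"
    by (rule inj_on_subset) (auto simp: word_graph_def)
  moreover have "wf_digraph ?G"
    by unfold_locales (auto simp: word_graph_def)
  ultimately have "pre_digraph.digraph_isomorphism ?G ?h"
    using assms by (simp add: pre_digraph.digraph_isomorphism_def) (simp add: word_graph_def)
  moreover have "with_proj (word_graph L (map f w)) = app_iso ?h ?G"
  proof -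
    have proj: "proj_morphism (f u) (f v) (map f w) = proj_morphism u v w"
      if "u \<in> set w" "v \<in> set w" for u v
      \<comment> \<open>Since \<open>u\<close> and \<open>v\<close> occur in \<open>w\<close>,
        injectivity on \<open>set w\<close> suffices.\<close>
      using assms that by (intro proj_morphism_map) (simp add: insert_absorb)
    have arc_iff:
      "(f u, f v) \<in> parcs (word_graph L (map f w)) \<longleftrightarrow> (u, v) \<in> parcs (word_graph L w)"
      if "u \<in> set w" "v \<in> set w" for u v
      using that by (simp add: word_graph_def proj inj_on_eq_iff[OF assms])
    have "parcs (word_graph L (map f w)) = map_prod f f ` parcs (word_graph L w)"
    proof (intro equalityI subrelI)
      fix a b assume ab: "(a, b) \<in> parcs (word_graph L (map f w))"
      then obtain u v where "u \<in> set w" "v \<in> set w" "a = f u" "b = f v"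
        by (auto simp: word_graph_def)
      then show "(a, b) \<in> map_prod f f ` parcs (word_graph L w)"
        using ab arc_iff by auto
    next
      fix a b assume "(a, b) \<in> map_prod f f ` parcs (word_graph L w)"
      then obtain u v where uv: "(u, v) \<in> parcs (word_graph L w)" "a = f u" "b = f v"
        by auto
      moreover from uv(1) have "u \<in> set w" "v \<in> set w"
        by (simp_all add: word_graph_def)
      ultimately show "(a, b) \<in> parcs (word_graph L (map f w))"
        using arc_iff by simp
    qed
    then show ?thesis
      by (simp add: with_proj_def app_iso_def) (simp add: word_graph_def)
  qed
  ultimately show ?thesis
    unfolding digraph_iso_def by blast
qed

text \<open>Representability asks for a word over the naturals; the finitely many letters of
  \<open>w\<close> embed into them.\<close>

lemma L_representable_word_graph:
  assumes "w \<noteq> []"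
  shows "L_representable L (word_graph L w)"
proof -
  obtain f :: "_ \<Rightarrow> nat" where "inj_on f (set w)"
    using finite_imp_inj_to_nat_seg[OF finite_set, of w] by blast
  then have "digraph_iso (with_proj (word_graph L w)) (with_proj (word_graph L (map f w)))"
    by (rule digraph_iso_word_graph_map)
  then show ?thesis
    unfolding L_representable_def using assms by (intro exI[of _ "map f w"]) simp
qed

theorem mainTheorem10:
  shows "(\<forall>G :: 'a pair_pre_digraph. simple_graph G \<longrightarrow> L_representable copy_language G) \<and>
    (representable_graphs copy_language :: 'a pair_pre_digraph set) = {G. simple_graph G}"
proof -
  have "L_representable copy_language G" if "simple_graph G" for G :: "'a pair_pre_digraph"
    using simple_graph_eq_word_graph_copy_language[OF that] L_representable_word_graph by metis
  then show ?thesis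
    \<comment> \<open>One inclusion is built into \<open>representable_graphs\<close>; the other is
      the fact just shown.\<close>
    by (auto simp: representable_graphs_def)
qed

end
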